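(* Let $P=(\mathcal{X},\mathcal{D},\mathcal{C})$ be a constraint satisfaction problem with finite, linearly ordered domains. Let $\Phi_{HA}(P)$, $\Phi_{R}(P)$ and $\Phi_{B}(P)$ denote the results of achieving hyper-arc consistency, range consistency and bound consistency on $P$, respectively. Then $$\Phi_{HA}(P)\preceq \Phi_{R}(P)\preceq \Phi_{B}(P).$$
   Context: Fix a linearly ordered set $U$ of values (for instance $\mathbb{Z}$). A constraint satisfaction problem (CSP) $P=(\mathcal{X},\mathcal{D},\mathcal{C})$ consists of a finite set of variables $\mathcal{X}=\{x_1,\dots,x_n\}$, finite domains $\mathcal{D}=\{D_1,\dots,D_n\}$ with $D_i\subseteq U$ associated with the variables, and a finite set $\mathcal{C}$ of constraints, each on a subset of $\mathcal{X}$. A constraint $C(x_{i_1},\dots,x_{i_m})$ on $m$ distinct variables is a relation $C\subseteq U^m$ (it does not change when domains are reduced). For $a\le b$ in $U$, $[a,b]=\{u\in U: a\le u\le b\}$; $\min D$ and $\max D$ are the least and greatest elements of a non-empty domain $D$. Let $C(x_1,\dots,x_m)$ be an $m$-ary constraint (variables relabelled) with no $D_i$ empty. - $C$ is bound consistent iff for each $i$ and each $d_i\in\{\min D_i,\max D_i\}$ there exist $d_j\in[\min D_j,\max D_j]$ for all $j\in\{1,\dots,m\}\setminus\{i\}$ such that $(d_1,\dots,d_m)\in C$. - $C$ is range consistent iff for each $i$ and each $d_i\in D_i$ there exist $d_j\in[\min D_j,\max D_j]$ for all $j\ne i$ such that $(d_1,\dots,d_m)\in C$. - $C$ is hyper-arc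 consistent iff for each $i$ and each $d_i\in D_i$ there exist $d_j\in D_j$ for all $j\ne i$ such that $(d_1,\dots,d_m)\in C$. A CSP is bound (respectively range, hyper-arc) consistent if all its constraints are. Order: for CSPs $P=(\mathcal{X},\mathcal{D},\mathcal{C})$ and $P'=(\mathcal{X}',\mathcal{D}',\mathcal{C}')$ on the same variables, $P\preceq P'$ means $\mathcal{D}\subseteq\mathcal{D}'$, i.e. $D_i\subseteq D_i'$ for every $i$. A CSP with at least one empty domain is called failed; all failed CSPs are identified with a single object $P_\emptyset$, which by convention is the smallest CSP ($P_\emptyset\preceq P'$ for all $P'$). Achieving consistency: for each of the three notions, $\Phi(P)$ is the largest (with respect to $\preceq$) CSP that has the same variables and constraints as $P$, has all domains non-empty and contained in the corresponding domains of $P$, and is consistent in the given sense; if no such CSP exists, $\Phi(P)=P_\emptyset$. The subscripts $HA$, $R$, $B$ correspond to hyper-arc, range and bound consistency. *)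

theory Defs
  imports Main
begin

text \<open>
  The ordered set of values is a type \<open>'u :: linorder\<close>; variables have type \<open>'v\<close>.
  A constraint is a pair \<open>(xs, C)\<close> of its list of variables \<open>xs\<close> and a relation \<open>C\<close>, whose
  tuples \<open>t\<close> are lists of the same length as \<open>xs\<close>, with \<open>t ! i\<close> the value of \<open>xs ! i\<close>.
\<close>

type_synonym ('v, 'u) constraint = "'v list \<times> 'u list set"

record ('v, 'u) csp =
  csp_vars :: "'v set"
  csp_dom :: "'v \<Rightarrow> 'u set"
  csp_constraints :: "('v, 'u) constraint set"

text \<open>
  The value of \<open>csp_dom\<close> outside the variables is fixed to \<open>{}\<close>, so that a well-formed problem
  is determined by its variables, the domains of these, and its constraints.
  Domains of variables may be empty (then the problem is failed).
\<close>

definition wf_csp :: "('v, 'u::linorder) csp \<Rightarrow> bool" where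
  "wf_csp P \<longleftrightarrow>
     finite (csp_vars P) \<and>
     (\<forall>x\<in>csp_vars P. finite (csp_dom P x)) \<and>
     (\<forall>x. x \<notin> csp_vars P \<longrightarrow> csp_dom P x = {}) \<and>
     finite (csp_constraints P) \<and>
     (\<forall>(xs, C)\<in>csp_constraints P.
        distinct xs \<and> set xs \<subseteq> csp_vars P \<and> (\<forall>t\<in>C. length t = length xs))"

definition failed :: "('v, 'u::linorder) csp \<Rightarrow> bool" where
  "failed P \<longleftrightarrow> (\<exists>x\<in>csp_vars P. csp_dom P x = {})"

text \<open>
  The three notions are meant for non-empty finite domains of the variables \<open>xs\<close>, where
  \<open>Min\<close> and \<open>Max\<close> are the least and greatest elements; below they are only
  applied to problems that are not failed.
\<close>

definition bound_consistent :: "('v \<Rightarrow> 'u::linorder set) \<Rightarrow> ('v, 'u) constraint \<Rightarrow> bool" where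
  "bound_consistent D = (\<lambda>(xs, C).
     \<forall>i<length xs. \<forall>d\<in>{Min (D (xs ! i)), Max (D (xs ! i))}.
       \<exists>t\<in>C. t ! i = d \<and>
         (\<forall>j<length xs. j \<noteq> i \<longrightarrow> t ! j \<in> {Min (D (xs ! j))..Max (D (xs ! j))}))"

definition range_consistent :: "('v \<Rightarrow> 'u::linorder set) \<Rightarrow> ('v, 'u) constraint \<Rightarrow> bool" where
  "range_consistent D = (\<lambda>(xs, C).
     \<forall>i<length xs. \<forall>d\<in>D (xs ! i).
       \<exists>t\<in>C. t ! i = d \<and>
         (\<forall>j<length xs. j \<noteq> i \<longrightarrow> t ! j \<in> {Min (D (xs ! j))..Max (D (xs ! j))}))"

definition hyper_arc_consistent :: "('v \<Rightarrow> 'u::linorder set) \<Rightarrow> ('v, 'u) constraint \<Rightarrow> bool" where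
  "hyper_arc_consistent D = (\<lambda>(xs, C).
     \<forall>i<length xs. \<forall>d\<in>D (xs ! i).
       \<exists>t\<in>C. t ! i = d \<and> (\<forall>j<length xs. j \<noteq> i \<longrightarrow> t ! j \<in> D (xs ! j)))"

definition csp_consistent ::
  "(('v \<Rightarrow> 'u::linorder set) \<Rightarrow> ('v, 'u) constraint \<Rightarrow> bool) \<Rightarrow> ('v, 'u) csp \<Rightarrow> bool" where
  "csp_consistent cons P \<longleftrightarrow> (\<forall>c\<in>csp_constraints P. cons (csp_dom P) c)"

definition domains_le :: "('v, 'u::linorder) csp \<Rightarrow> ('v, 'u) csp \<Rightarrow> bool" where
  "domains_le P P' \<longleftrightarrow>
     csp_vars P = csp_vars P' \<and> (\<forall>x\<in>csp_vars P. csp_dom P x \<subseteq> csp_dom P' x)"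

text \<open>
  Problems up to identification of all failed ones with a single object \<open>P\<^sub>\<emptyset>\<close>.
  \<open>Proper\<close> is only meant for problems that are not failed.
\<close>

datatype ('v, 'u) csp_object = Failed (\<open>P\<^sub>\<emptyset>\<close>) | Proper "('v, 'u) csp"

fun csp_le :: "('v, 'u::linorder) csp_object \<Rightarrow> ('v, 'u) csp_object \<Rightarrow> bool"
  (infix \<open>\<preceq>\<close> 50) where
  "P\<^sub>\<emptyset> \<preceq> Q \<longleftrightarrow> True"
| "Proper P \<preceq> P\<^sub>\<emptyset> \<longleftrightarrow> False"
| "Proper P \<preceq> Proper P' \<longleftrightarrow> domains_le P P'"

definition consistent_reductions ::
  "(('v \<Rightarrow> 'u::linorder set) \<Rightarrow> ('v, 'u) constraint \<Rightarrow> bool) \<Rightarrow> ('v, 'u) csp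
    \<Rightarrow> ('v, 'u) csp set" where
  "consistent_reductions cons P =
     {Q. wf_csp Q \<and> csp_vars Q = csp_vars P \<and> csp_constraints Q = csp_constraints P \<and>
         \<not> failed Q \<and> (\<forall>x\<in>csp_vars P. csp_dom Q x \<subseteq> csp_dom P x) \<and> csp_consistent cons Q}"

definition achieve ::
  "(('v \<Rightarrow> 'u::linorder set) \<Rightarrow> ('v, 'u) constraint \<Rightarrow> bool) \<Rightarrow> ('v, 'u) csp
    \<Rightarrow> ('v, 'u) csp_object" where
  "achieve cons P =
     (if consistent_reductions cons P = {} then P\<^sub>\<emptyset>
      else Proper (THE Q. Q \<in> consistent_reductions cons P \<and>
                     (\<forall>Q'\<in>consistent_reductions cons P. Proper Q' \<preceq> Proper Q)))"

definition Phi_HA :: "('v, 'u::linorder) csp \<Rightarrow> ('v, 'u) csp_object" (\<open>\<Phi>\<^sub>H\<^sub>A\<close>) where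
  "\<Phi>\<^sub>H\<^sub>A = achieve hyper_arc_consistent"

definition Phi_R :: "('v, 'u::linorder) csp \<Rightarrow> ('v, 'u) csp_object" (\<open>\<Phi>\<^sub>R\<close>) where
  "\<Phi>\<^sub>R = achieve range_consistent"

definition Phi_B :: "('v, 'u::linorder) csp \<Rightarrow> ('v, 'u) csp_object" (\<open>\<Phi>\<^sub>B\<close>) where
  "\<Phi>\<^sub>B = achieve bound_consistent"

end

theory Submission
  imports Defs
begin

text \<open>
  Each of the three notions is preserved when the domains of a family of consistent problems are
  united pointwise, because supports survive as domains and their hulls grow, and an extremal value
  of a union is an extremal value of the member containing it. Hence the union of all consistent
  reductions is the largest one. Hyper-arc consistency implies range consistency, which implies
  bound consistency, so the sets of consistent reductions, and their largest elements, are ordered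
  accordingly.
\<close>

text \<open>The premises keep the hulls meaningful: finiteness is asked of the union, so that
  infinite families are covered, and neither the family nor its members may be empty, since
  \<open>Min\<close> and \<open>Max\<close> of an empty set are unspecified.\<close>

definition union_stable ::
  "(('v \<Rightarrow> 'u::linorder set) \<Rightarrow> ('v, 'u) constraint \<Rightarrow> bool) \<Rightarrow> bool" where
  "union_stable cons \<longleftrightarrow>
     (\<forall>\<D> xs C. (\<forall>x\<in>set xs. finite (\<Union>D\<in>\<D>. D x)) \<longrightarrow>
        (\<forall>D\<in>\<D>. (\<forall>x\<in>set xs. D x \<noteq> {}) \<and> cons D (xs, C)) \<longrightarrow> \<D> \<noteq> {} \<longrightarrow>
        cons (\<lambda>x. \<Union>D\<in>\<D>. D x) (xs, C))"

lemma hull_mono: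
  fixes A B :: "'u::linorder set"
  assumes "A \<subseteq> B" "A \<noteq> {}" "finite B"
  shows "{Min A..Max A} \<subseteq> {Min B..Max B}"
  using Min_antimono[OF assms] Max_mono[OF assms] by auto

lemma union_stable_hyper_arc_consistent: "union_stable hyper_arc_consistent"
  unfolding union_stable_def
proof (intro allI impI)
  fix \<D> :: "('v \<Rightarrow> 'u::linorder set) set" and xs C
  let ?U = "\<lambda>x. \<Union>D\<in>\<D>. D x"
  assume cons: "\<forall>D\<in>\<D>. (\<forall>x\<in>set xs. D x \<noteq> {}) \<and> hyper_arc_consistent D (xs, C)"
  show "hyper_arc_consistent ?U (xs, C)"
    unfolding hyper_arc_consistent_def prod.case
  proof (intro allI impI ballI)
    fix i d assume i: "i < length xs" and "d \<in> ?U (xs ! i)"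
    then obtain D where D: "D \<in> \<D>" "d \<in> D (xs ! i)" by blast
    then have "hyper_arc_consistent D (xs, C)" using cons by blast
    then obtain t where "t \<in> C" "t ! i = d" "\<forall>j<length xs. j \<noteq> i \<longrightarrow> t ! j \<in> D (xs ! j)"
      using D(2) i unfolding hyper_arc_consistent_def prod.case by blast
    then show "\<exists>t\<in>C. t ! i = d \<and> (\<forall>j<length xs. j \<noteq> i \<longrightarrow> t ! j \<in> ?U (xs ! j))"
      using D(1) by blast
  qed
qed

text \<open>The support of \<open>d\<close> found in the member that contributes \<open>d\<close>
  lies in hulls that only widen on passing to the union.\<close>

lemma union_stable_range_consistent: "union_stable range_consistent"
  unfolding union_stable_def
proof (intro allI impI)
  fix \<D> :: "('v \<Rightarrow> 'u::linorder set) set" and xs C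
  let ?U = "\<lambda>x. \<Union>D\<in>\<D>. D x"
  assume fin: "\<forall>x\<in>set xs. finite (?U x)"
    and cons: "\<forall>D\<in>\<D>. (\<forall>x\<in>set xs. D x \<noteq> {}) \<and> range_consistent D (xs, C)"
  show "range_consistent ?U (xs, C)"
    unfolding range_consistent_def prod.case
  proof (intro allI impI ballI)
    fix i d assume i: "i < length xs" and "d \<in> ?U (xs ! i)"
    then obtain D where D: "D \<in> \<D>" "d \<in> D (xs ! i)" by blast
    have hull: "{Min (D (xs ! j))..Max (D (xs ! j))} \<subseteq> {Min (?U (xs ! j))..Max (?U (xs ! j))}"
      if "j < length xs" for j
      using that fin cons D(1) by (intro hull_mono) auto
    have "range_consistent D (xs, C)" using cons D(1) by blast
    then obtain t where "t \<in> C" "t ! i = d"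
      "\<forall>j<length xs. j \<noteq> i \<longrightarrow> t ! j \<in> {Min (D (xs ! j))..Max (D (xs ! j))}"
      using D(2) i unfolding range_consistent_def prod.case by blast
    then show "\<exists>t\<in>C. t ! i = d \<and>
        (\<forall>j<length xs. j \<noteq> i \<longrightarrow> t ! j \<in> {Min (?U (xs ! j))..Max (?U (xs ! j))})"
      using hull by blast
  qed
qed

text \<open>Members provide supports only for their own extremal values, so the extremal value of
  the union must first be recognised as extremal in some member.\<close>

lemma union_stable_bound_consistent: "union_stable bound_consistent"
  unfolding union_stable_def
proof (intro allI impI)
  fix \<D> :: "('v \<Rightarrow> 'u::linorder set) set" and xs C
  let ?U = "\<lambda>x. \<Union>D\<in>\<D>. D x"
  assume fin: "\<forall>x\<in>set xs. finite (?U x)"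
    and cons: "\<forall>D\<in>\<D>. (\<forall>x\<in>set xs. D x \<noteq> {}) \<and> bound_consistent D (xs, C)"
    and ne: "\<D> \<noteq> {}"
  show "bound_consistent ?U (xs, C)"
    unfolding bound_consistent_def prod.case
  proof (intro allI impI ballI)
    fix i d assume i: "i < length xs" and d: "d \<in> {Min (?U (xs ! i)), Max (?U (xs ! i))}"
    have U: "finite (?U (xs ! i))" "?U (xs ! i) \<noteq> {}"
      using i fin cons ne by auto
    \<comment> \<open>The extremal values of a finite non-empty set are attained, hence come from
      some member \<open>D\<close>.\<close>
    then have "d \<in> ?U (xs ! i)"
      using d Min_in[OF U] Max_in[OF U] by (elim insertE emptyE) (simp_all only:)
    then obtain D where D: "D \<in> \<D>" "d \<in> D (xs ! i)" by blast
    have sub: "D (xs ! i) \<subseteq> ?U (xs ! i)" using D by blast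
    have finD: "finite (D (xs ! i))" by (rule finite_subset[OF sub U(1)])
    \<comment> \<open>Bounds of the union also bound the smaller set \<open>D (xs ! i)\<close>; as
      \<open>d\<close> belongs to it, \<open>d\<close> is its minimum or maximum.\<close>
    have "Min (?U (xs ! i)) \<le> y" "y \<le> Max (?U (xs ! i))" if "y \<in> D (xs ! i)" for y
      using that sub U(1) by (meson Min_le Max_ge subsetD)+
    then have ext: "d \<in> {Min (D (xs ! i)), Max (D (xs ! i))}"
      using d Min_eqI[OF finD _ D(2)] Max_eqI[OF finD _ D(2)] by auto
    have hull:
      "{Min (D (xs ! j))..Max (D (xs ! j))} \<subseteq> {Min (?U (xs ! j))..Max (?U (xs ! j))}"
      if "j < length xs" for j
      using that fin cons D(1) by (intro hull_mono) auto
    have "bound_consistent D (xs, C)" using cons D(1) by blast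
    then obtain t where "t \<in> C" "t ! i = d"
      "\<forall>j<length xs. j \<noteq> i \<longrightarrow> t ! j \<in> {Min (D (xs ! j))..Max (D (xs ! j))}"
      using ext i unfolding bound_consistent_def prod.case by blast
    then show "\<exists>t\<in>C. t ! i = d \<and>
        (\<forall>j<length xs. j \<noteq> i \<longrightarrow> t ! j \<in> {Min (?U (xs ! j))..Max (?U (xs ! j))})"
      using hull by blast
  qed
qed

text \<open>Antisymmetry of the order, which makes a largest reduction unique. Outside the
  variables, where \<open>domains_le\<close> says nothing, well-formedness forces both domains to be
  empty.\<close>

lemma wf_csp_eqI:
  fixes Q Q' :: "('v, 'u::linorder) csp"
  assumes "wf_csp Q" "wf_csp Q'" "csp_constraints Q = csp_constraints Q'"
    and "domains_le Q Q'" "domains_le Q' Q"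
  shows "Q = Q'"
proof -
  have vars: "csp_vars Q = csp_vars Q'" using assms(4) by (simp add: domains_le_def)
  have "csp_dom Q x = csp_dom Q' x" for x
  proof (cases "x \<in> csp_vars Q'")
    case True
    then show ?thesis using assms(4,5) vars unfolding domains_le_def by blast
  next
    case False
    then show ?thesis using assms(1,2) vars unfolding wf_csp_def by metis
  qed
  then have "csp_dom Q = csp_dom Q'" by (rule ext)
  with vars assms(3) show ?thesis by simp
qed

lemma greatest_consistent_reduction:
  fixes P :: "('v, 'u::linorder) csp"
  assumes wf: "wf_csp P" and stable: "union_stable cons"
    and ne: "consistent_reductions cons P \<noteq> {}"
  obtains Q where "Q \<in> consistent_reductions cons P"
    and "\<And>Q'. Q' \<in> consistent_reductions cons P \<Longrightarrow> domains_le Q' Q"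
proof
  let ?R = "consistent_reductions cons P"
  let ?U = "\<lambda>x. \<Union>D\<in>csp_dom ` ?R. D x"
  \<comment> \<open>The candidate takes the union of the domains of all consistent reductions, so it
    dominates each of them by construction; what remains is that it is itself one.\<close>
  define Q where "Q = P\<lparr>csp_dom := ?U\<rparr>"
  have sub: "?U x \<subseteq> csp_dom P x" if "x \<in> csp_vars P" for x
    using that unfolding consistent_reductions_def by auto
  have fin: "finite (?U x)" if "x \<in> csp_vars P" for x
  proof (rule finite_subset[OF sub[OF that]])
    show "finite (csp_dom P x)" using that wf unfolding wf_csp_def by blast
  qed
  have out: "?U x = {}" if "x \<notin> csp_vars P" for x
    using that unfolding consistent_reductions_def wf_csp_def by auto
  have nonempty: "csp_dom Q' x \<noteq> {}" if "Q' \<in> ?R" "x \<in> csp_vars P" for Q' x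
    using that unfolding consistent_reductions_def failed_def by auto
  have "cons ?U c" if c: "c \<in> csp_constraints P" for c
  proof -
    obtain xs C where [simp]: "c = (xs, C)" by (cases c)
    have xs: "set xs \<subseteq> csp_vars P" using wf c unfolding wf_csp_def by auto
    have "cons (csp_dom Q') (xs, C)" if "Q' \<in> ?R" for Q'
      using that c unfolding consistent_reductions_def csp_consistent_def by auto
    \<comment> \<open>Stability is applied to the family of domain maps of all consistent
      reductions.\<close>
    then have "\<forall>D\<in>csp_dom ` ?R. (\<forall>x\<in>set xs. D x \<noteq> {}) \<and> cons D (xs, C)"
      using nonempty xs by blast
    moreover have "\<forall>x\<in>set xs. finite (?U x)" using fin xs by blast
    moreover have "csp_dom ` ?R \<noteq> {}" using ne by blast
    ultimately have "cons ?U (xs, C)"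
      using stable unfolding union_stable_def by blast
    then show ?thesis by simp
  qed
  moreover have "wf_csp Q"
    using wf fin out unfolding Q_def wf_csp_def by simp
  moreover have "\<not> failed Q"
    using ne nonempty unfolding Q_def failed_def by auto
  ultimately show "Q \<in> ?R"
    using sub unfolding Q_def consistent_reductions_def csp_consistent_def by simp
  show "domains_le Q' Q" if "Q' \<in> ?R" for Q'
    using that unfolding Q_def domains_le_def by (auto simp: consistent_reductions_def)
qed

text \<open>Justifies the definite description in \<open>achieve\<close>: a largest reduction exists
  by the union construction and is unique by antisymmetry.\<close>

lemma achieve_eq_Proper:
  fixes P :: "('v, 'u::linorder) csp"
  assumes "wf_csp P" "union_stable cons" "consistent_reductions cons P \<noteq> {}"
  obtains Q where "achieve cons P = Proper Q" "Q \<in> consistent_reductions cons P"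
    and "\<And>Q'. Q' \<in> consistent_reductions cons P \<Longrightarrow> domains_le Q' Q"
proof -
  obtain Q where Q: "Q \<in> consistent_reductions cons P"
    "\<And>Q'. Q' \<in> consistent_reductions cons P \<Longrightarrow> domains_le Q' Q"
    using greatest_consistent_reduction[OF assms] by blast
  have "(THE Q. Q \<in> consistent_reductions cons P \<and>
      (\<forall>Q'\<in>consistent_reductions cons P. Proper Q' \<preceq> Proper Q)) = Q"
  proof (rule the_equality)
    fix Q' assume Q': "Q' \<in> consistent_reductions cons P \<and>
      (\<forall>Q''\<in>consistent_reductions cons P. Proper Q'' \<preceq> Proper Q')"
    show "Q' = Q"
    proof (rule wf_csp_eqI)
      show "wf_csp Q'" "wf_csp Q" "csp_constraints Q' = csp_constraints Q"
        using Q(1) Q' by (auto simp: consistent_reductions_def)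
    qed (use Q Q' in auto)
  qed (use Q in auto)
  then show ?thesis
    using that Q assms(3) unfolding achieve_def by simp
qed

text \<open>If the smaller set of reductions is empty, the left side is the least object. Otherwise
  its largest element also belongs to the larger set, whose largest element dominates it.\<close>

lemma achieve_mono:
  fixes P :: "('v, 'u::linorder) csp"
  assumes "wf_csp P" "union_stable cons" "union_stable cons'"
    and sub: "consistent_reductions cons P \<subseteq> consistent_reductions cons' P"
  shows "achieve cons P \<preceq> achieve cons' P"
proof (cases "consistent_reductions cons P = {}")
  case True
  then show ?thesis by (simp add: achieve_def)
next
  case False
  obtain Q where "achieve cons P = Proper Q" "Q \<in> consistent_reductions cons P"
    using achieve_eq_Proper[OF assms(1,2) False] by blast
  moreover obtain Q' where "achieve cons' P = Proper Q'"
    "\<And>Q. Q \<in> consistent_reductions cons' P \<Longrightarrow> domains_le Q Q'"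
    using achieve_eq_Proper[OF assms(1,3)] False sub by blast
  ultimately show ?thesis using sub by auto
qed

lemma hyper_arc_consistent_imp_range_consistent:
  assumes "\<forall>x\<in>set xs. finite (D x)" "hyper_arc_consistent D (xs, C)"
  shows "range_consistent D (xs, C)"
  unfolding range_consistent_def prod.case
proof (intro allI impI ballI)
  fix i d assume "i < length xs" "d \<in> D (xs ! i)"
  then obtain t where "t \<in> C" "t ! i = d" "\<forall>j<length xs. j \<noteq> i \<longrightarrow> t ! j \<in> D (xs ! j)"
    using assms(2) unfolding hyper_arc_consistent_def prod.case by blast
  \<comment> \<open>A finite set lies in its hull, so a support inside the domains is also one
    inside the hulls.\<close>
  moreover have "D (xs ! j) \<subseteq> {Min (D (xs ! j))..Max (D (xs ! j))}" if "j < length xs" for j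
    using assms(1) that by auto
  ultimately show "\<exists>t\<in>C. t ! i = d \<and>
      (\<forall>j<length xs. j \<noteq> i \<longrightarrow> t ! j \<in> {Min (D (xs ! j))..Max (D (xs ! j))})"
    by blast
qed

text \<open>The minimum and maximum of a finite non-empty domain are among its values, all of which
  have supports in the hulls.\<close>

lemma range_consistent_imp_bound_consistent:
  assumes "\<forall>x\<in>set xs. finite (D x) \<and> D x \<noteq> {}" "range_consistent D (xs, C)"
  shows "bound_consistent D (xs, C)"
proof -
  have "{Min (D (xs ! i)), Max (D (xs ! i))} \<subseteq> D (xs ! i)" if "i < length xs" for i
    using assms(1) that by auto
  then show ?thesis
    using assms(2) unfolding range_consistent_def bound_consistent_def prod.case by blast
qed

text \<open>Reductions are well-formed and not failed, so the domains of the variables of each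
  constraint are finite and non-empty, as the implication between the two notions requires.\<close>

lemma consistent_reductions_mono:
  fixes P :: "('v, 'u::linorder) csp"
  assumes "\<And>D xs C. \<forall>x\<in>set xs. finite (D x) \<and> D x \<noteq> {} \<Longrightarrow> cons D (xs, C) \<Longrightarrow> cons' D (xs, C)"
  shows "consistent_reductions cons P \<subseteq> consistent_reductions cons' P"
proof
  fix Q assume Q: "Q \<in> consistent_reductions cons P"
  then have wf: "wf_csp Q" and "\<not> failed Q" "csp_consistent cons Q"
    by (auto simp: consistent_reductions_def)
  have "cons' (csp_dom Q) (xs, C)" if c: "(xs, C) \<in> csp_constraints Q" for xs C
  proof (rule assms)
    have "set xs \<subseteq> csp_vars Q" using wf c unfolding wf_csp_def by auto
    moreover have "\<forall>x\<in>csp_vars Q. finite (csp_dom Q x)" using wf by (simp add: wf_csp_def)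
    moreover have "\<forall>x\<in>csp_vars Q. csp_dom Q x \<noteq> {}"
      using \<open>\<not> failed Q\<close> by (simp add: failed_def)
    ultimately show "\<forall>x\<in>set xs. finite (csp_dom Q x) \<and> csp_dom Q x \<noteq> {}"
      by blast
    show "cons (csp_dom Q) (xs, C)"
      using c \<open>csp_consistent cons Q\<close> unfolding csp_consistent_def by blast
  qed
  then show "Q \<in> consistent_reductions cons' P"
    using Q unfolding consistent_reductions_def csp_consistent_def by auto
qed

theorem proposition1:
  fixes P :: "('v, 'u::linorder) csp"
  assumes "wf_csp P"
  shows "\<Phi>\<^sub>H\<^sub>A P \<preceq> \<Phi>\<^sub>R P \<and> \<Phi>\<^sub>R P \<preceq> \<Phi>\<^sub>B P"
  unfolding Phi_HA_def Phi_R_def Phi_B_def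
proof
  show "achieve hyper_arc_consistent P \<preceq> achieve range_consistent P"
    using assms union_stable_hyper_arc_consistent union_stable_range_consistent
    by (rule achieve_mono)
      (rule consistent_reductions_mono, simp add: hyper_arc_consistent_imp_range_consistent)
  show "achieve range_consistent P \<preceq> achieve bound_consistent P"
    using assms union_stable_range_consistent union_stable_bound_consistent
    by (rule achieve_mono)
      (rule consistent_reductions_mono, rule range_consistent_imp_bound_consistent)
qed

end
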